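(* For every $d\in\mathbb{N}$ the Rademacher chaos of order $d$ has the random unconditional convergence property in $L_\infty([0,1])$, that is, there is a constant $C_d'>0$ (depending only on $d$) such that for all $n\in\mathbb{N}$ and all $a_{\vec j}\in\mathbb{R}$, $\vec j\in\Delta_n^d$, $$ \mathsf{E}_\theta\Big\|\sum_{\vec j\in\Delta_n^d}\theta_{\vec j}\,a_{\vec j}\,\mathrm{r}_{\vec j}\Big\|_{L_\infty([0,1])}\le C_d'\Big\|\sum_{\vec j\in\Delta_n^d}a_{\vec j}\,\mathrm{r}_{\vec j}\Big\|_{L_\infty([0,1])}. $$
   Context: The Rademacher functions are $r_i(t)=(-1)^{[2^i t]}$, $t\in[0,1]$, $i=1,2,\dots$, where $[x]$ is the integer part of $x$. $\Delta_n^d=\{(j_1,\dots,j_d)\in\mathbb{N}^d: j_1<j_2<\dots<j_d\le n\}$, and for $\vec j=(j_1,\dots,j_d)$ with $j_1<\dots<j_d$, $\mathrm{r}_{\vec j}(t)=r_{j_1}(t)r_{j_2}(t)\cdots r_{j_d}(t)$, $t\in[0,1]$; these functions form the Rademacher chaos of order $d$. $\mathsf{E}_\theta$ denotes the expectation (uniform average) over all arrangements of signs $\theta_{\vec j}=\pm1$, $\vec j\in\Delta_n^d$. *)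

theory Defs
  imports "HOL-Probability.Probability"
begin

definition rademacher :: "nat \<Rightarrow> real \<Rightarrow> real" where
  "rademacher i t = (-1) ^ nat \<lfloor>2 ^ i * t\<rfloor>"

(* A tuple (j_1, ..., j_d) is the list [j_1, ..., j_d]; indices start at 1, as the
   Rademacher functions r_1, r_2, ... do. *)
definition chaos_indices :: "nat \<Rightarrow> nat \<Rightarrow> nat list set" where
  "chaos_indices d n = {js. length js = d \<and> sorted_wrt (<) js \<and> set js \<subseteq> {1..n}}"

definition rademacher_chaos :: "nat list \<Rightarrow> real \<Rightarrow> real" where
  "rademacher_chaos js t = (\<Prod>j\<leftarrow>js. rademacher j t)"

definition sign_arrangements :: "'i set \<Rightarrow> ('i \<Rightarrow> real) set" where
  "sign_arrangements I = (\<Pi>\<^sub>E j\<in>I. {-1, 1})"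

(* Real-valued, hence meaningful only for measurable, essentially bounded f; see
   Linf_norm_chaos below for the functions of interest. *)
definition Linf_norm :: "(real \<Rightarrow> real) \<Rightarrow> real" where
  "Linf_norm f = real_of_ereal (esssup (lebesgue_on {0..1}) (\<lambda>t. ereal \<bar>f t\<bar>))"

lemma finite_chaos_indices: "finite (chaos_indices d n)"
  by (rule finite_subset[OF _ finite_lists_length_eq[of "{1..n}" d]])
     (auto simp: chaos_indices_def)

lemma finite_sign_arrangements: "finite I \<Longrightarrow> finite (sign_arrangements I)"
  by (auto simp: sign_arrangements_def intro!: finite_PiE)

lemma sign_arrangements_nonempty: "sign_arrangements I \<noteq> {}"
  by (simp add: sign_arrangements_def PiE_eq_empty_iff)

lemma rademacher_measurable: "rademacher i \<in> borel_measurable borel"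
  unfolding rademacher_def[abs_def] by measurable

lemma rademacher_chaos_measurable: "rademacher_chaos js \<in> borel_measurable borel"
proof (induction js)
  case (Cons i js)
  then show ?case
    using rademacher_measurable[of i] by (simp add: rademacher_chaos_def[abs_def])
qed (simp add: rademacher_chaos_def[abs_def])

lemma abs_rademacher_chaos: "\<bar>rademacher_chaos js t\<bar> = 1"
  by (induction js) (auto simp: rademacher_chaos_def rademacher_def abs_mult power_abs)

lemma Linf_norm_chaos:
  fixes c :: "nat list \<Rightarrow> real"
  shows "ereal (Linf_norm (\<lambda>t. \<Sum>j\<in>J. c j * rademacher_chaos j t)) =
    esssup (lebesgue_on {0..1}) (\<lambda>t. ereal \<bar>\<Sum>j\<in>J. c j * rademacher_chaos j t\<bar>)"
    (is "_ = esssup ?M ?f")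
proof -
  have "(\<lambda>t. \<Sum>j\<in>J. c j * rademacher_chaos j t) \<in> borel_measurable borel"
    by (intro borel_measurable_sum borel_measurable_times rademacher_chaos_measurable
        borel_measurable_const)
  then have "(\<lambda>t. \<Sum>j\<in>J. c j * rademacher_chaos j t) \<in> borel_measurable lebesgue"
    by (simp add: measurable_completion)
  then have meas: "?f \<in> borel_measurable ?M"
    by (intro borel_measurable_ereal borel_measurable_abs measurable_restrict_space1)
  have "\<bar>\<Sum>j\<in>J. c j * rademacher_chaos j t\<bar> \<le> (\<Sum>j\<in>J. \<bar>c j\<bar>)" for t
    by (rule order_trans[OF sum_abs]) (simp add: abs_mult abs_rademacher_chaos)
  then have upper: "esssup ?M ?f \<le> ereal (\<Sum>j\<in>J. \<bar>c j\<bar>)"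
    by (intro esssup_I meas) auto
  have "emeasure ?M (space ?M) \<noteq> 0"
    by (simp add: emeasure_restrict_space space_restrict_space)
  then have "0 = esssup ?M (\<lambda>_. 0 :: ereal)"
    by (intro esssup_const[symmetric])
  also have "\<dots> \<le> esssup ?M ?f"
    by (rule esssup_AE_mono) auto
  finally show ?thesis
    using upper unfolding Linf_norm_def by (intro ereal_real') auto
qed

end

theory Submission
  imports Defs
begin

text \<open>
  A sum of the chaos is read as the multilinear polynomial
  $P(x) = \sum_j a_j \prod_{i \in j} x_i$ on the sign cube. The Rademacher functions attain every
  sign vector on a dyadic interval, so the $L_\infty$ norm is the maximum of $|P|$ on the cube.
  Both sides of the inequality are compared with one quantity, the sum over the coordinates $i$ of
  the influences $A_i = (\sum_{j \ni i} a_j^2)^{1/2}$.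

  Without random signs, $\sum_i A_i \le C_d \max |P|$ (\<open>sum_influences_le\<close>). Moving away from a
  vertex into the cube and bounding the linear coefficient of a polynomial of degree $d$ in one
  variable by its maximum gives $\sum_i |\partial_i P(x)| \le C_d \max |P|$ at every vertex $x$.
  Averaging over $x$ leaves the $L_1$ norms of the $\partial_i P$; by Bonami's fourth moment
  inequality these are comparable to the $L_2$ norms, which are the $A_i$ by Parseval.

  With random signs, the expected maximum is at most $8 \sum_i A_i$
  (\<open>random_sup_le_sum_influences\<close>). The coordinates are sorted by decreasing influence, and
  the monomials are divided into blocks by the least $k$ such that all their variables are among
  the first $2^{k+1} - 1$. The $k$-th block depends on fewer than $2^{k+1}$ signs, and its
  coefficients have squares summing to at most $2^k \alpha_k^2$, where $\alpha_k$ is the influence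
  of the $2^k$-th coordinate. The subgaussian maximal inequality over the at most $2^{2^{k+1}}$ sign
  vectors bounds its expected maximum by $4 \cdot 2^k \alpha_k$, and by Cauchy condensation these
  bounds add up to at most $8 \sum_i A_i$.
\<close>

section \<open>Averages over sign arrangements\<close>

definition sign_mean :: "'i set \<Rightarrow> (('i \<Rightarrow> real) \<Rightarrow> real) \<Rightarrow> real" where
  "sign_mean I f = (\<Sum>x\<in>sign_arrangements I. f x) / 2 ^ card I"

lemma sign_mean_eq_expectation:
  assumes "finite I"
  shows "measure_pmf.expectation (pmf_of_set (sign_arrangements I)) f = sign_mean I f"
proof -
  have "card (sign_arrangements I) = 2 ^ card I"
    using assms by (simp add: sign_arrangements_def card_PiE numeral_2_eq_2)
  then show ?thesis
    using assms by (simp add: sign_mean_def integral_pmf_of_set finite_sign_arrangements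
        sign_arrangements_nonempty)
qed

text \<open>
  The only sign arrangement on the empty index set takes the default value everywhere.
\<close>

lemma sign_mean_empty: "sign_mean {} f = f (\<lambda>_. undefined)"
  by (simp add: sign_mean_def sign_arrangements_def)

text \<open>
  Averaging one sign at a time; every induction over the sign cube below rests on this.
\<close>

lemma sign_mean_insert:
  assumes "finite I" "i \<notin> I"
  shows "sign_mean (insert i I) f =
    (sign_mean I (\<lambda>x. f (x(i := 1))) + sign_mean I (\<lambda>x. f (x(i := -1)))) / 2"
proof -
  let ?S = "sign_arrangements I"
  have inj: "inj_on (\<lambda>(y, g). g(i := y)) ({-1, 1} \<times> ?S)"
    using inj_combinator[OF assms(2), of "\<lambda>_. {-1, 1}"] by (simp add: sign_arrangements_def)
  have "(\<Sum>x\<in>sign_arrangements (insert i I). f x) = (\<Sum>(y, g)\<in>{-1, 1} \<times> ?S. f (g(i := y)))"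
    unfolding sign_arrangements_def PiE_insert_eq
    using inj[unfolded sign_arrangements_def]
    by (subst sum.reindex) (auto simp: case_prod_unfold)
  also have "\<dots> = (\<Sum>y\<in>{-1, 1}. \<Sum>g\<in>?S. f (g(i := y)))"
    by (simp only: sum.cartesian_product)
  finally show ?thesis
    using assms by (simp add: sign_mean_def field_simps)
qed

lemma sign_mean_mono:
  "(\<And>x. x \<in> sign_arrangements I \<Longrightarrow> f x \<le> g x) \<Longrightarrow> sign_mean I f \<le> sign_mean I g"
  by (simp add: sign_mean_def divide_right_mono sum_mono)

lemma sign_mean_add: "sign_mean I (\<lambda>x. f x + g x) = sign_mean I f + sign_mean I g"
  by (simp add: sign_mean_def sum.distrib add_divide_distrib)

lemma sign_mean_diff: "sign_mean I (\<lambda>x. f x - g x) = sign_mean I f - sign_mean I g"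
  by (simp add: sign_mean_def sum_subtractf diff_divide_distrib)

lemma sign_mean_cmult: "sign_mean I (\<lambda>x. c * f x) = c * sign_mean I f"
  by (simp add: sign_mean_def sum_distrib_left)

lemma sign_mean_sum: "sign_mean I (\<lambda>x. \<Sum>k\<in>K. f k x) = (\<Sum>k\<in>K. sign_mean I (f k))"
  unfolding sign_mean_def by (subst sum.swap) (simp add: sum_divide_distrib)

lemma sign_mean_const: "finite I \<Longrightarrow> sign_mean I (\<lambda>_. c) = c"
  by (simp add: sign_mean_def sign_arrangements_def card_PiE)

lemma sign_mean_nonneg: "(\<And>x. 0 \<le> f x) \<Longrightarrow> 0 \<le> sign_mean I f"
  by (simp add: sign_mean_def sum_nonneg)

lemma sign_mean_mult_squared_le:
  "(sign_mean I (\<lambda>x. f x * g x))\<^sup>2 \<le> sign_mean I (\<lambda>x. (f x)\<^sup>2) * sign_mean I (\<lambda>x. (g x)\<^sup>2)"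
  using Cauchy_Schwarz_ineq_sum[of f g "sign_arrangements I"]
  by (simp add: sign_mean_def power_divide divide_right_mono flip: power2_eq_square)

section \<open>Moments of polynomials on the sign cube\<close>

text \<open>
  The coefficients are indexed by all subsets of \<open>I\<close>, and a bound on the degree is expressed by
  vanishing coefficients: then both parts obtained by splitting off a variable are again of this form.
\<close>

definition walsh_poly :: "'i set \<Rightarrow> ('i set \<Rightarrow> real) \<Rightarrow> ('i \<Rightarrow> real) \<Rightarrow> real" where
  "walsh_poly I b x = (\<Sum>S\<in>Pow I. b S * (\<Prod>i\<in>S. x i))"

lemma sum_Pow_insert:
  fixes f :: "'i set \<Rightarrow> real"
  assumes "finite I" "i \<notin> I"
  shows "(\<Sum>S\<in>Pow (insert i I). f S) = (\<Sum>S\<in>Pow I. f (insert i S)) + (\<Sum>S\<in>Pow I. f S)"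
proof -
  have inj: "inj_on (insert i) (Pow I)"
    using assms(2) by (intro inj_onI) (auto dest!: insert_ident[THEN iffD1, rotated 2])
  have "(\<Sum>S\<in>Pow (insert i I). f S) = (\<Sum>S\<in>Pow I. f S) + (\<Sum>S\<in>insert i ` Pow I. f S)"
    unfolding Pow_insert using assms by (intro sum.union_disjoint) auto
  also have "(\<Sum>S\<in>insert i ` Pow I. f S) = (\<Sum>S\<in>Pow I. f (insert i S))"
    by (simp add: sum.reindex[OF inj])
  finally show ?thesis by simp
qed

lemma walsh_poly_cong:
  "(\<And>i. i \<in> I \<Longrightarrow> x i = y i) \<Longrightarrow> walsh_poly I b x = walsh_poly I b y"
  unfolding walsh_poly_def by (intro sum.cong refl arg_cong2[of _ _ _ _ "(*)"] prod.cong) auto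

text \<open>
  Splitting off the variable $x_i$ as $P = x_i h + r$, where $h$ and $r$ do not depend on $x_i$.
\<close>

lemma walsh_poly_insert:
  assumes "finite I" "i \<notin> I"
  shows "walsh_poly (insert i I) b x =
    x i * walsh_poly I (\<lambda>S. b (insert i S)) x + walsh_poly I b x"
proof -
  have "b (insert i S) * (\<Prod>k\<in>insert i S. x k) = x i * (b (insert i S) * (\<Prod>k\<in>S. x k))"
    if "S \<in> Pow I" for S
    using that assms finite_subset[of S I] by (subst prod.insert) auto
  then show ?thesis
    unfolding walsh_poly_def sum_Pow_insert[OF assms] sum_distrib_left
    by (intro arg_cong2[of _ _ _ _ "(+)"] sum.cong refl)
qed

lemma walsh_poly_insert_upd:
  assumes "finite I" "i \<notin> I"
  shows "walsh_poly (insert i I) b (x(i := c)) =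
    c * walsh_poly I (\<lambda>S. b (insert i S)) x + walsh_poly I b x"
proof -
  have *: "walsh_poly I b' (x(i := c)) = walsh_poly I b' x" for b'
    using assms(2) by (intro walsh_poly_cong) auto
  show ?thesis
    unfolding walsh_poly_insert[OF assms] by (simp add: *)
qed

text \<open>
  Parseval's identity: averaging $(x_i h + r)^2$ over the sign $x_i$ removes the cross term
  $2 x_i h r$.
\<close>

lemma sign_mean_walsh_poly_squared:
  assumes "finite I"
  shows "sign_mean I (\<lambda>x. (walsh_poly I b x)\<^sup>2) = (\<Sum>S\<in>Pow I. (b S)\<^sup>2)"
  using assms
proof (induction I arbitrary: b rule: finite_induct)
  case empty
  then show ?case by (simp add: sign_mean_empty walsh_poly_def)
next
  case (insert i I)
  let ?h = "walsh_poly I (\<lambda>S. b (insert i S))" and ?r = "walsh_poly I b"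
  have "sign_mean (insert i I) (\<lambda>x. (walsh_poly (insert i I) b x)\<^sup>2) =
      sign_mean I (\<lambda>x. (1/2) * ((1 * ?h x + ?r x)\<^sup>2 + (-1 * ?h x + ?r x)\<^sup>2))"
    unfolding sign_mean_insert[OF insert.hyps] walsh_poly_insert_upd[OF insert.hyps]
      sign_mean_cmult sign_mean_add by simp
  also have "\<dots> = sign_mean I (\<lambda>x. (?h x)\<^sup>2 + (?r x)\<^sup>2)"
    by (intro arg_cong[of _ _ "sign_mean I"] ext) (simp add: power2_eq_square algebra_simps)
  finally show ?case
    by (simp add: sign_mean_add insert.IH sum_Pow_insert[OF insert.hyps])
qed

text \<open>
  Bonami's hypercontractive inequality for the exponents 2 and 4. Averaging $(x_i h + r)^4$ over the
  sign $x_i$ leaves $h^4 + 6 h^2 r^2 + r^4$. The middle term is controlled by the Cauchy-Schwarz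
  inequality, and since $h$ has a degree lower by one, the factor 3 between the square roots of the
  constants for $r$ and $h$ turns the 6 into the 2 of $(\mathsf{E} h^2 + \mathsf{E} r^2)^2$.
\<close>

lemma bonami_fourth_moment:
  assumes "finite I" "\<And>S. S \<subseteq> I \<Longrightarrow> d < card S \<Longrightarrow> b S = 0"
  shows "sign_mean I (\<lambda>x. (walsh_poly I b x) ^ 4) \<le> 9 ^ d * (sign_mean I (\<lambda>x. (walsh_poly I b x)\<^sup>2))\<^sup>2"
  using assms
proof (induction I arbitrary: b d rule: finite_induct)
  case empty
  have "b {} ^ 4 \<le> 9 ^ d * b {} ^ 4"
    by (simp add: mult_le_cancel_right1)
  then show ?case by (simp add: sign_mean_empty walsh_poly_def flip: power_mult)
next
  case (insert i I)
  let ?h = "walsh_poly I (\<lambda>S. b (insert i S))" and ?r = "walsh_poly I b"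
  let ?E = "sign_mean I"
  let ?H = "?E (\<lambda>x. (?h x)\<^sup>2)" and ?R = "?E (\<lambda>x. (?r x)\<^sup>2)"
  have nonneg: "0 \<le> ?H" "0 \<le> ?R" by (auto intro: sign_mean_nonneg)
  have E2: "sign_mean (insert i I) (\<lambda>x. (walsh_poly (insert i I) b x)\<^sup>2) = ?H + ?R"
    by (simp add: sign_mean_walsh_poly_squared insert.hyps sum_Pow_insert)
  have "sign_mean (insert i I) (\<lambda>x. (walsh_poly (insert i I) b x) ^ 4) =
      ?E (\<lambda>x. (1/2) * ((1 * ?h x + ?r x) ^ 4 + (-1 * ?h x + ?r x) ^ 4))"
    unfolding sign_mean_insert[OF insert.hyps] walsh_poly_insert_upd[OF insert.hyps]
      sign_mean_cmult sign_mean_add by simp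
  also have "\<dots> = ?E (\<lambda>x. (?h x) ^ 4 + 6 * ((?h x)\<^sup>2 * (?r x)\<^sup>2) + (?r x) ^ 4)"
    by (intro arg_cong[of _ _ "sign_mean I"] ext)
      (simp add: power2_eq_square power4_eq_xxxx algebra_simps)
  also have "\<dots> = ?E (\<lambda>x. (?h x) ^ 4) + 6 * ?E (\<lambda>x. (?h x)\<^sup>2 * (?r x)\<^sup>2) + ?E (\<lambda>x. (?r x) ^ 4)"
    by (simp add: sign_mean_add sign_mean_cmult)
  finally have E4: "sign_mean (insert i I) (\<lambda>x. (walsh_poly (insert i I) b x) ^ 4) = \<dots>" .
  have r4: "?E (\<lambda>x. (?r x) ^ 4) \<le> 9 ^ d * ?R\<^sup>2"
    using insert.prems by (intro insert.IH) auto
  show ?case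
  proof (cases d)
    case 0
    have "b (insert i S) = 0" if "S \<subseteq> I" for S
      using insert.prems[of "insert i S"] that 0 insert.hyps finite_subset[of S I]
      by (auto simp: card_gt_0_iff)
    then have "?h x = 0" for x by (simp add: walsh_poly_def)
    then show ?thesis using r4 unfolding E4 E2
      by (simp add: sign_mean_def)
  next
    case (Suc e)
    have "b (insert i S) = 0" if "S \<subseteq> I" "e < card S" for S
    proof -
      have "finite S" "i \<notin> S" using that insert.hyps finite_subset by auto
      then show ?thesis using that Suc by (intro insert.prems) auto
    qed
    then have h4: "?E (\<lambda>x. (?h x) ^ 4) \<le> 9 ^ e * ?H\<^sup>2"
      by (intro insert.IH) auto
    have "(?E (\<lambda>x. (?h x)\<^sup>2 * (?r x)\<^sup>2))\<^sup>2 \<le> ?E (\<lambda>x. ((?h x)\<^sup>2)\<^sup>2) * ?E (\<lambda>x. ((?r x)\<^sup>2)\<^sup>2)"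
      by (rule sign_mean_mult_squared_le)
    also have "\<dots> \<le> (9 ^ e * ?H\<^sup>2) * (9 ^ d * ?R\<^sup>2)"
      using h4 r4 by (intro mult_mono) (auto intro!: sign_mean_nonneg simp flip: power_mult)
    also have "\<dots> = (3 * 9 ^ e * (?H * ?R))\<^sup>2"
      by (simp add: Suc power2_eq_square)
    finally have "?E (\<lambda>x. (?h x)\<^sup>2 * (?r x)\<^sup>2) \<le> 3 * 9 ^ e * (?H * ?R)"
      by (rule power2_le_imp_le) (use nonneg in simp)
    with h4 r4 have "sign_mean (insert i I) (\<lambda>x. (walsh_poly (insert i I) b x) ^ 4) \<le>
        9 ^ e * ?H\<^sup>2 + 6 * (3 * 9 ^ e * (?H * ?R)) + 9 ^ d * ?R\<^sup>2"
      unfolding E4 by linarith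
    also have "\<dots> \<le> 9 ^ d * ?H\<^sup>2 + 6 * (3 * 9 ^ e * (?H * ?R)) + 9 ^ d * ?R\<^sup>2"
      by (simp add: Suc)
    also have "\<dots> = 9 ^ d * (?H + ?R)\<^sup>2"
      by (simp add: Suc power2_eq_square algebra_simps)
    finally show ?thesis unfolding E2 .
  qed
qed

text \<open>
  A bounded fourth moment prevents the mass from concentrating on a few points, so the $L_1$ norm
  cannot be much smaller than the $L_2$ norm. This is the interpolation of $L_2$ between $L_1$ and
  $L_4$, obtained by averaging a pointwise inequality.
\<close>

lemma l2_norm_le_sign_mean_abs:
  assumes "finite I" "\<And>S. S \<subseteq> I \<Longrightarrow> d < card S \<Longrightarrow> b S = 0"
  shows "sqrt (\<Sum>S\<in>Pow I. (b S)\<^sup>2) \<le> 3 ^ d * sign_mean I (\<lambda>x. \<bar>walsh_poly I b x\<bar>)"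
proof (cases "(\<Sum>S\<in>Pow I. (b S)\<^sup>2) = 0")
  case True
  then show ?thesis unfolding True by (simp add: sign_mean_nonneg)
next
  case False
  define \<sigma> where "\<sigma> = sqrt (\<Sum>S\<in>Pow I. (b S)\<^sup>2)"
  have pos: "\<sigma> > 0"
    using False sum_nonneg[of "Pow I" "\<lambda>S. (b S)\<^sup>2"] by (simp add: \<sigma>_def less_le)
  define K :: real where "K = 3 ^ d"
  have K: "K > 0" by (simp add: K_def)
  let ?g = "walsh_poly I b"
  have two: "sign_mean I (\<lambda>x. (?g x)\<^sup>2) = \<sigma>\<^sup>2"
    by (simp add: sign_mean_walsh_poly_squared assms(1) \<sigma>_def sum_nonneg)
  have four: "sign_mean I (\<lambda>x. (?g x) ^ 4) \<le> K\<^sup>2 * \<sigma> ^ 4"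
  proof -
    have "K\<^sup>2 = 9 ^ d"
      by (simp add: K_def power2_eq_square flip: power_mult_distrib)
    then show ?thesis
      using bonami_fourth_moment[where b = b, OF assms] unfolding two by (simp flip: power_mult)
  qed
  \<comment> \<open>$2 + w^3 \ge 3 w$, scaled so that the averages on the left reproduce $\sigma / K$\<close>
  have pointwise: "3 / 2 * (u\<^sup>2 / (K * \<sigma>)) - 1 / 2 * (u ^ 4 / (K * \<sigma>) ^ 3) \<le> \<bar>u\<bar>" for u :: real
  proof -
    define w where "w = \<bar>u\<bar> / (K * \<sigma>)"
    have w: "w \<ge> 0" "\<bar>u\<bar> = w * (K * \<sigma>)" using pos K by (auto simp: w_def)
    have "u\<^sup>2 = \<bar>u\<bar>\<^sup>2" "u ^ 4 = \<bar>u\<bar> ^ 4" by simp_all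
    have "0 \<le> (w - 1)\<^sup>2 * (w + 2)" using w by simp
    then have "3 / 2 * w - 1 / 2 * w ^ 3 \<le> 1"
      by (simp add: power2_eq_square power3_eq_cube algebra_simps)
    from mult_right_mono[OF this, of "\<bar>u\<bar>"]
    have "3 / 2 * (w * \<bar>u\<bar>) - 1 / 2 * (w ^ 3 * \<bar>u\<bar>) \<le> \<bar>u\<bar>"
      by (simp add: algebra_simps)
    also have "w * \<bar>u\<bar> = u\<^sup>2 / (K * \<sigma>)"
      by (simp add: w_def power2_eq_square)
    also have "w ^ 3 * \<bar>u\<bar> = u ^ 4 / (K * \<sigma>) ^ 3"
      unfolding \<open>u ^ 4 = _\<close> by (simp add: w_def power_divide power3_eq_cube power4_eq_xxxx)
    finally show ?thesis .
  qed
  have "\<sigma> / K = 3 / 2 * (\<sigma>\<^sup>2 / (K * \<sigma>)) - 1 / 2 * (K\<^sup>2 * \<sigma> ^ 4 / (K * \<sigma>) ^ 3)"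
    using pos K by (simp add: field_simps power2_eq_square power3_eq_cube power4_eq_xxxx)
  also have "\<dots> \<le> 3 / 2 * (\<sigma>\<^sup>2 / (K * \<sigma>)) - 1 / 2 * (sign_mean I (\<lambda>x. (?g x) ^ 4) / (K * \<sigma>) ^ 3)"
    using four pos K by (simp add: divide_right_mono)
  also have "\<dots> = sign_mean I (\<lambda>x. 3 / 2 * ((?g x)\<^sup>2 / (K * \<sigma>)) - 1 / 2 * ((?g x) ^ 4 / (K * \<sigma>) ^ 3))"
    unfolding sign_mean_diff sign_mean_cmult two[symmetric]
    by (simp add: sign_mean_def sum_divide_distrib mult.commute)
  also have "\<dots> \<le> sign_mean I (\<lambda>x. \<bar>?g x\<bar>)"
    by (intro sign_mean_mono pointwise)
  finally show ?thesis
    using K by (simp add: field_simps \<sigma>_def K_def)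
qed

section \<open>Bounding the influences by the maximum\<close>

text \<open>
  On the finite-dimensional space of polynomials of degree at most $d$, every coefficient is bounded
  by the maximum on $[0, 1]$. For the linear coefficient, $p(t) - 2^{d+1} p(t/2)$ has a degree lower
  by one than $p$ of degree $d+1$, and its linear coefficient is $(1 - 2^d) c_1$, which is
  not smaller than $c_1$ in absolute value.
\<close>

lemma linear_coefficient_le_sup:
  assumes "d \<ge> 1"
  shows "\<exists>C>0. \<forall>(c :: nat \<Rightarrow> real) M.
    (\<forall>t\<in>{0..1}. \<bar>\<Sum>m\<le>d. c m * t ^ m\<bar> \<le> M) \<longrightarrow> \<bar>c 1\<bar> \<le> C * M"
  using assms
proof (induction d rule: nat_induct_at_least)
  case base
  show ?case
  proof (intro exI[of _ 2] conjI allI impI)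
    fix c :: "nat \<Rightarrow> real" and M
    assume *: "\<forall>t\<in>{0..1}. \<bar>\<Sum>m\<le>1. c m * t ^ m\<bar> \<le> M"
    from *[rule_format, of 0] *[rule_format, of 1] show "\<bar>c 1\<bar> \<le> 2 * M"
      by simp
  qed simp
next
  case (Suc d)
  from Suc.IH obtain C where C: "C > 0"
    "\<And>(c :: nat \<Rightarrow> real) M. (\<forall>t\<in>{0..1}. \<bar>\<Sum>m\<le>d. c m * t ^ m\<bar> \<le> M) \<Longrightarrow> \<bar>c 1\<bar> \<le> C * M"
    by blast
  show ?case
  proof (intro exI[of _ "C * (1 + 2 ^ Suc d)"] conjI allI impI)
    fix c :: "nat \<Rightarrow> real" and M
    assume *: "\<forall>t\<in>{0..1}. \<bar>\<Sum>m\<le>Suc d. c m * t ^ m\<bar> \<le> M"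
    let ?p = "\<lambda>t. \<Sum>m\<le>Suc d. c m * t ^ m"
    let ?c' = "\<lambda>m. c m - 2 ^ Suc d * (c m / 2 ^ m)"
    have "\<bar>\<Sum>m\<le>d. ?c' m * t ^ m\<bar> \<le> (1 + 2 ^ Suc d) * M" if t: "t \<in> {0..1}" for t :: real
    proof -
      \<comment> \<open>the substitution of t/2 is scaled to cancel the leading coefficient\<close>
      have "(\<Sum>m\<le>d. ?c' m * t ^ m) = (\<Sum>m\<le>Suc d. ?c' m * t ^ m)"
        by simp
      also have "\<dots> = ?p t - 2 ^ Suc d * ?p (t / 2)"
        unfolding sum_distrib_left sum_subtractf[symmetric]
        by (intro sum.cong refl) (simp add: algebra_simps power_divide)
      finally have "\<bar>\<Sum>m\<le>d. ?c' m * t ^ m\<bar> \<le> \<bar>?p t\<bar> + \<bar>2 ^ Suc d * ?p (t / 2)\<bar>"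
        by simp
      also have "\<bar>2 ^ Suc d * ?p (t / 2)\<bar> = 2 ^ Suc d * \<bar>?p (t / 2)\<bar>"
        by (simp add: abs_mult)
      also have "\<bar>?p t\<bar> + \<dots> \<le> M + 2 ^ Suc d * M"
        using t by (intro add_mono mult_left_mono *[rule_format]) auto
      finally show ?thesis by (simp add: algebra_simps)
    qed
    then have "\<bar>?c' 1\<bar> \<le> C * ((1 + 2 ^ Suc d) * M)"
      by (intro C(2)) blast
    moreover have "\<bar>c 1\<bar> \<le> \<bar>?c' 1\<bar>"
    proof -
      have "(2::real) ^ d \<ge> 2 ^ 1"
        using Suc.hyps by (intro power_increasing) auto
      then have "1 * \<bar>c 1\<bar> \<le> (2 ^ d - 1) * \<bar>c 1\<bar>"
        by (intro mult_right_mono) auto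
      also have "\<dots> = \<bar>(2 ^ d - 1) * c 1\<bar>"
        using \<open>2 ^ d \<ge> 2 ^ 1\<close> by (simp add: abs_mult)
      also have "\<dots> = \<bar>?c' 1\<bar>"
        by (subst abs_minus_commute) (simp add: algebra_simps)
      finally show ?thesis by simp
    qed
    ultimately show "\<bar>c 1\<bar> \<le> C * (1 + 2 ^ Suc d) * M"
      by (simp add: mult.assoc)
  qed (use C(1) in \<open>simp add: add_pos_pos\<close>)
qed

text \<open>
  A multilinear polynomial is affine in each variable, so on the solid cube it attains its extreme
  values at vertices.
\<close>

lemma walsh_poly_le_on_cube:
  assumes "finite I"
    and "\<And>x. x \<in> sign_arrangements I \<Longrightarrow> \<bar>walsh_poly I b x\<bar> \<le> M"
    and "\<And>i. i \<in> I \<Longrightarrow> \<bar>x i\<bar> \<le> 1"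
  shows "\<bar>walsh_poly I b x\<bar> \<le> M"
  using assms
proof (induction I arbitrary: b rule: finite_induct)
  case empty
  then show ?case by (simp add: walsh_poly_def sign_arrangements_def)
next
  case (insert i I)
  let ?b = "\<lambda>S. x i * b (insert i S) + b S"
  have eq: "walsh_poly I ?b y =
      x i * walsh_poly I (\<lambda>S. b (insert i S)) y + walsh_poly I b y" for y
    by (simp add: walsh_poly_def sum.distrib sum_distrib_left algebra_simps)
  have "\<bar>walsh_poly I ?b y\<bar> \<le> M" if y: "y \<in> sign_arrangements I" for y
  proof -
    let ?h = "walsh_poly I (\<lambda>S. b (insert i S)) y" and ?r = "walsh_poly I b y"
    have "y(i := s) \<in> sign_arrangements (insert i I)" if "s \<in> {-1, 1}" for s
      using y that unfolding sign_arrangements_def by (intro PiE_fun_upd) auto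
    from insert.prems(1)[OF this]
    have "\<bar>s * ?h + ?r\<bar> \<le> M" if "s \<in> {-1, 1}" for s
      using that unfolding walsh_poly_insert_upd[OF insert.hyps] by blast
    from this[of 1] this[of "-1"] have "\<bar>?h + ?r\<bar> \<le> M" "\<bar>?r - ?h\<bar> \<le> M" by auto
    moreover have "\<bar>x i * ?h\<bar> \<le> \<bar>?h\<bar>"
      using insert.prems(2)[of i] by (simp add: abs_mult mult_left_le_one_le)
    ultimately show ?thesis unfolding eq by linarith
  qed
  then have "\<bar>walsh_poly I ?b x\<bar> \<le> M"
    using insert.prems(2) by (intro insert.IH) auto
  then show ?case
    by (simp add: eq walsh_poly_insert[OF insert.hyps])
qed

text \<open>
  The formal partial derivative in the direction $i$. The case distinction makes its coefficients at
  sets containing $i$ vanish, so that it does not depend on $x_i$ and its coefficients square-sum to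
  the squared influence of $i$.
\<close>

definition walsh_partial :: "'i set \<Rightarrow> ('i set \<Rightarrow> real) \<Rightarrow> 'i \<Rightarrow> ('i \<Rightarrow> real) \<Rightarrow> real" where
  "walsh_partial I b i = walsh_poly I (\<lambda>S. if i \<in> S then 0 else b (insert i S))"

lemma sum_Pow_containing:
  fixes f :: "'i set \<Rightarrow> real"
  assumes "finite I" "i \<in> I"
  shows "(\<Sum>S\<in>Pow I. if i \<in> S then 0 else f (insert i S)) = (\<Sum>S | S \<subseteq> I \<and> i \<in> S. f S)"
proof -
  have "(\<Sum>S\<in>Pow I. if i \<in> S then 0 else f (insert i S)) = (\<Sum>S | S \<subseteq> I \<and> i \<notin> S. f (insert i S))"
    using assms(1) by (intro sum.mono_neutral_cong_right) auto
  also have "\<dots> = (\<Sum>S | S \<subseteq> I \<and> i \<in> S. f S)"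
    using assms(2) by (intro sum.reindex_bij_witness[of _ "\<lambda>S. S - {i}" "insert i"]) auto
  finally show ?thesis .
qed

text \<open>
  On a line through $x$ the polynomial becomes one of degree at most $d$ in the single variable $t$,
  with the directional derivative at $x$ as its linear coefficient. The coefficient of $t^m$ collects
  the subsets $U$ of size $m$ on which the product over $S$ takes its factors from $v$.
\<close>

lemma walsh_poly_along_line:
  fixes b :: "'i set \<Rightarrow> real"
  assumes "finite I" "\<And>S. S \<subseteq> I \<Longrightarrow> d < card S \<Longrightarrow> b S = 0"
  shows "\<exists>c. (\<forall>t. walsh_poly I b (\<lambda>i. x i + t * v i) = (\<Sum>m\<le>d. c m * t ^ m)) \<and>
    c 1 = (\<Sum>i\<in>I. v i * walsh_partial I b i x)"
proof -
  let ?w = "\<lambda>S U. b S * ((\<Prod>i\<in>U. v i) * (\<Prod>i\<in>S - U. x i))"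
  define c where "c m = (\<Sum>S\<in>Pow I. \<Sum>U | U \<in> Pow S \<and> card U = m. ?w S U)" for m
  have "walsh_poly I b (\<lambda>i. x i + t * v i) = (\<Sum>m\<le>d. c m * t ^ m)" for t
  proof -
    have "b S * (\<Prod>i\<in>S. x i + t * v i) =
        (\<Sum>m\<le>d. (\<Sum>U | U \<in> Pow S \<and> card U = m. ?w S U) * t ^ m)" if S: "S \<in> Pow I" for S
    proof (cases "d < card S")
      case True
      then have "b S = 0" using S assms(2) by auto
      then show ?thesis by simp
    next
      case False
      have fin: "finite S" using S assms(1) finite_subset by auto
      have "b S * (\<Prod>i\<in>S. x i + t * v i) = b S * (\<Prod>i\<in>S. t * v i + x i)"
        by (simp add: add.commute)
      also have "\<dots> = (\<Sum>U\<in>Pow S. ?w S U * t ^ card U)"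
        unfolding prod_add[OF fin] sum_distrib_left
        by (intro sum.cong refl) (simp add: prod.distrib mult_ac)
      also have "\<dots> = (\<Sum>m\<le>d. \<Sum>U | U \<in> Pow S \<and> card U = m. ?w S U * t ^ card U)"
        using fin False by (intro sum.group[symmetric])
          (auto intro: order_trans[OF card_mono])
      also have "\<dots> = (\<Sum>m\<le>d. (\<Sum>U | U \<in> Pow S \<and> card U = m. ?w S U) * t ^ m)"
        unfolding sum_distrib_right by (intro sum.cong refl) auto
      finally show ?thesis .
    qed
    then have "walsh_poly I b (\<lambda>i. x i + t * v i) =
        (\<Sum>S\<in>Pow I. \<Sum>m\<le>d. (\<Sum>U | U \<in> Pow S \<and> card U = m. ?w S U) * t ^ m)"
      unfolding walsh_poly_def by (intro sum.cong refl)
    also have "\<dots> = (\<Sum>m\<le>d. c m * t ^ m)"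
      by (subst sum.swap) (simp add: c_def sum_distrib_right)
    finally show ?thesis .
  qed
  moreover have "c 1 = (\<Sum>i\<in>I. v i * walsh_partial I b i x)"
  proof -
    have "(\<Sum>U | U \<in> Pow S \<and> card U = 1. ?w S U) =
        (\<Sum>i\<in>I. if i \<in> S then b S * (v i * (\<Prod>k\<in>S - {i}. x k)) else 0)" if S: "S \<in> Pow I" for S
    proof -
      have "{U. U \<in> Pow S \<and> card U = 1} = (\<lambda>i. {i}) ` S"
        by (auto simp: card_1_singleton_iff)
      then have "(\<Sum>U | U \<in> Pow S \<and> card U = 1. ?w S U) = (\<Sum>i\<in>S. ?w S {i})"
        by (simp add: sum.reindex)
      also have "\<dots> = (\<Sum>i\<in>I. if i \<in> S then b S * (v i * (\<Prod>k\<in>S - {i}. x k)) else 0)"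
        using S assms(1) by (intro sum.mono_neutral_cong_left) auto
      finally show ?thesis .
    qed
    then have "c 1 = (\<Sum>S\<in>Pow I. \<Sum>i\<in>I. if i \<in> S then b S * (v i * (\<Prod>k\<in>S - {i}. x k)) else 0)"
      unfolding c_def by (intro sum.cong refl)
    also have "\<dots> = (\<Sum>i\<in>I. \<Sum>S\<in>Pow I. if i \<in> S then b S * (v i * (\<Prod>k\<in>S - {i}. x k)) else 0)"
      by (rule sum.swap)
    also have "\<dots> = (\<Sum>i\<in>I. v i * walsh_partial I b i x)"
    proof (rule sum.cong[OF refl])
      fix i assume i: "i \<in> I"
      let ?f = "\<lambda>S. b S * (v i * (\<Prod>k\<in>S - {i}. x k))"
      have "(\<Sum>S\<in>Pow I. if i \<in> S then ?f S else 0) = (\<Sum>S | S \<subseteq> I \<and> i \<in> S. ?f S)"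
        using assms(1) by (intro sum.mono_neutral_cong_right) auto
      also have "\<dots> = (\<Sum>S\<in>Pow I. if i \<in> S then 0 else ?f (insert i S))"
        by (rule sum_Pow_containing[symmetric]) (use assms i in auto)
      also have "\<dots> = v i * walsh_partial I b i x"
        unfolding walsh_partial_def walsh_poly_def sum_distrib_left
        by (intro sum.cong refl) auto
      finally show "(\<Sum>S\<in>Pow I. if i \<in> S then ?f S else 0) = v i * walsh_partial I b i x" .
    qed
    finally show ?thesis .
  qed
  ultimately show ?thesis by blast
qed

text \<open>
  From a vertex $x$, the segment to the point with the coordinates in $J$ set to 0 stays in the solid
  cube. Along it the polynomial has the derivative $-\sum_{i \in J} x_i \partial_i P(x)$ at $x$, which
  is therefore bounded by the maximum. Taking for $J$ the coordinates where the summand is negative,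
  and those where it is not, gives the sum of the absolute values.
\<close>

lemma sum_abs_walsh_partial_le:
  assumes "d \<ge> 1"
  obtains C where "C > 0"
    and "\<And>I (b :: 'i set \<Rightarrow> real) M x. finite I \<Longrightarrow> (\<And>S. S \<subseteq> I \<Longrightarrow> d < card S \<Longrightarrow> b S = 0) \<Longrightarrow>
      (\<And>x. x \<in> sign_arrangements I \<Longrightarrow> \<bar>walsh_poly I b x\<bar> \<le> M) \<Longrightarrow>
      x \<in> sign_arrangements I \<Longrightarrow> (\<Sum>i\<in>I. \<bar>walsh_partial I b i x\<bar>) \<le> C * M"
proof -
  obtain C where C: "C > 0"
    "\<And>(c :: nat \<Rightarrow> real) M. (\<forall>t\<in>{0..1}. \<bar>\<Sum>m\<le>d. c m * t ^ m\<bar> \<le> M) \<Longrightarrow> \<bar>c 1\<bar> \<le> C * M"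
    using linear_coefficient_le_sup[OF assms] by blast
  show ?thesis
  proof (rule that[of "2 * C"])
    fix I and b :: "'i set \<Rightarrow> real" and M x
    assume fin: "finite I" and deg: "\<And>S. S \<subseteq> I \<Longrightarrow> d < card S \<Longrightarrow> b S = 0"
      and M: "\<And>x. x \<in> sign_arrangements I \<Longrightarrow> \<bar>walsh_poly I b x\<bar> \<le> M"
      and x: "x \<in> sign_arrangements I"
    let ?D = "\<lambda>i. walsh_partial I b i x"
    have x': "x i = -1 \<or> x i = 1" if "i \<in> I" for i
      using x that by (auto simp: sign_arrangements_def)
    have part: "\<bar>\<Sum>i\<in>J. x i * ?D i\<bar> \<le> C * M" if "J \<subseteq> I" for J
    proof -
      let ?v = "\<lambda>i. if i \<in> J then - x i else 0"
      have "\<exists>c. (\<forall>t. walsh_poly I b (\<lambda>i. x i + t * ?v i) = (\<Sum>m\<le>d. c m * t ^ m)) \<and>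
          c 1 = (\<Sum>i\<in>I. ?v i * ?D i)"
        by (rule walsh_poly_along_line[OF fin]) (rule deg)
      then obtain c where c: "(\<forall>t. walsh_poly I b (\<lambda>i. x i + t * ?v i) = (\<Sum>m\<le>d. c m * t ^ m)) \<and>
          c 1 = (\<Sum>i\<in>I. ?v i * ?D i)" ..
      have "\<bar>\<Sum>m\<le>d. c m * t ^ m\<bar> \<le> M" if t: "t \<in> {0..1}" for t :: real
        unfolding conjunct1[OF c, rule_format, symmetric]
      proof (rule walsh_poly_le_on_cube[OF fin])
        show "\<bar>x i + t * ?v i\<bar> \<le> 1" if "i \<in> I" for i
          using x'[OF that] t by auto
      qed (use M in auto)
      then have "\<bar>c 1\<bar> \<le> C * M" by (intro C(2) ballI)
      moreover have "c 1 = - (\<Sum>i\<in>J. x i * ?D i)"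
        unfolding conjunct2[OF c] sum_negf[symmetric] using fin that by (intro sum.mono_neutral_cong_right) auto
      ultimately show ?thesis by simp
    qed
    let ?N = "{i \<in> I. x i * ?D i < 0}"
    have "(\<Sum>i\<in>I. \<bar>?D i\<bar>) = (\<Sum>i\<in>I - ?N. \<bar>?D i\<bar>) + (\<Sum>i\<in>?N. \<bar>?D i\<bar>)"
      using fin by (intro sum.subset_diff) auto
    also have "(\<Sum>i\<in>I - ?N. \<bar>?D i\<bar>) = (\<Sum>i\<in>I - ?N. x i * ?D i)"
      using x' by (intro sum.cong refl) force
    also have "(\<Sum>i\<in>?N. \<bar>?D i\<bar>) = - (\<Sum>i\<in>?N. x i * ?D i)"
      unfolding sum_negf[symmetric] using x' by (intro sum.cong refl) force
    finally show "(\<Sum>i\<in>I. \<bar>?D i\<bar>) \<le> 2 * C * M"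
      using part[of "I - ?N"] part[of ?N] by auto
  qed (use C(1) in simp)
qed

text \<open>
  Averaging the bound on the gradient over all vertices gives the $L_1$ norms of the partial
  derivatives, and these dominate the $L_2$ norms, which are the influences.
\<close>

lemma sum_influences_le:
  assumes "d \<ge> 1"
  obtains C where "C > 0"
    and "\<And>I (b :: 'i set \<Rightarrow> real) M. finite I \<Longrightarrow> (\<And>S. S \<subseteq> I \<Longrightarrow> d < card S \<Longrightarrow> b S = 0) \<Longrightarrow>
      (\<And>x. x \<in> sign_arrangements I \<Longrightarrow> \<bar>walsh_poly I b x\<bar> \<le> M) \<Longrightarrow>
      (\<Sum>i\<in>I. sqrt (\<Sum>S | S \<subseteq> I \<and> i \<in> S. (b S)\<^sup>2)) \<le> C * M"
proof (rule sum_abs_walsh_partial_le[OF assms])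
  fix C
  assume C: "C > 0"
    "\<And>I (b :: 'i set \<Rightarrow> real) M x. finite I \<Longrightarrow> (\<And>S. S \<subseteq> I \<Longrightarrow> d < card S \<Longrightarrow> b S = 0) \<Longrightarrow>
      (\<And>x. x \<in> sign_arrangements I \<Longrightarrow> \<bar>walsh_poly I b x\<bar> \<le> M) \<Longrightarrow>
      x \<in> sign_arrangements I \<Longrightarrow> (\<Sum>i\<in>I. \<bar>walsh_partial I b i x\<bar>) \<le> C * M"
  show thesis
  proof (rule that[of "3 ^ d * C"])
    fix I and b :: "'i set \<Rightarrow> real" and M
    assume fin: "finite I" and deg: "\<And>S. S \<subseteq> I \<Longrightarrow> d < card S \<Longrightarrow> b S = 0"
      and M: "\<And>x. x \<in> sign_arrangements I \<Longrightarrow> \<bar>walsh_poly I b x\<bar> \<le> M"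
    have "sqrt (\<Sum>S | S \<subseteq> I \<and> i \<in> S. (b S)\<^sup>2) \<le>
        3 ^ d * sign_mean I (\<lambda>x. \<bar>walsh_partial I b i x\<bar>)" if i: "i \<in> I" for i
    proof -
      have "(\<Sum>S | S \<subseteq> I \<and> i \<in> S. (b S)\<^sup>2) = (\<Sum>S\<in>Pow I. (if i \<in> S then 0 else b (insert i S))\<^sup>2)"
        unfolding sum_Pow_containing[OF fin i, symmetric] by (intro sum.cong refl) auto
      moreover have "(if i \<in> S then 0 else b (insert i S)) = 0" if "S \<subseteq> I" "d < card S" for S
        using that deg i finite_subset[OF that(1) fin] by auto
      ultimately show ?thesis
        unfolding walsh_partial_def by (simp only: l2_norm_le_sign_mean_abs[OF fin])
    qed
    then have "(\<Sum>i\<in>I. sqrt (\<Sum>S | S \<subseteq> I \<and> i \<in> S. (b S)\<^sup>2)) \<le>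
        (\<Sum>i\<in>I. 3 ^ d * sign_mean I (\<lambda>x. \<bar>walsh_partial I b i x\<bar>))"
      by (rule sum_mono)
    also have "\<dots> = 3 ^ d * sign_mean I (\<lambda>x. \<Sum>i\<in>I. \<bar>walsh_partial I b i x\<bar>)"
      by (simp add: sign_mean_sum sum_distrib_left)
    also have "\<dots> \<le> 3 ^ d * sign_mean I (\<lambda>_. C * M)"
    proof (intro mult_left_mono sign_mean_mono)
      fix x assume "x \<in> sign_arrangements I"
      with fin deg M show "(\<Sum>i\<in>I. \<bar>walsh_partial I b i x\<bar>) \<le> C * M"
        by (rule C(2))
    qed simp
    also have "\<dots> = 3 ^ d * C * M"
      by (simp add: sign_mean_const[OF fin])
    finally show "(\<Sum>i\<in>I. sqrt (\<Sum>S | S \<subseteq> I \<and> i \<in> S. (b S)\<^sup>2)) \<le> 3 ^ d * C * M" .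
  next
    show "0 < 3 ^ d * C" using \<open>C > 0\<close> by simp
  qed
qed

section \<open>The expected maximum of a randomly signed polynomial\<close>

text \<open>
  The bound $\cosh x \le e^{x^2/2}$. It is Hoeffding's lemma for a fair sign, whose logarithmic moment
  generating function satisfies $\ln \cosh x = -|x| + \ln (1 + (e^{2|x|} - 1)/2)$.
\<close>

lemma exp_add_exp_uminus_le: "(exp x + exp (-x)) / 2 \<le> exp (x\<^sup>2 / 2)" for x :: real
proof -
  define E where "E = exp (2 * \<bar>x\<bar>)"
  have u: "1 + 1/2 * (E - 1) = (1 + E) / 2" "(1 + E) / 2 > 0"
    by (simp_all add: E_def add_pos_pos field_split_simps)
  have "- (2 * \<bar>x\<bar>) * (1/2) + ln (1 + 1/2 * (E - 1)) \<le> (2 * \<bar>x\<bar>)\<^sup>2 / 8"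
    unfolding E_def by (rule Hoeffdings_lemma_aux) auto
  then have "ln ((1 + E) / 2) \<le> \<bar>x\<bar> + x\<^sup>2 / 2"
    unfolding u(1) by (simp add: power_mult_distrib)
  then have "exp (ln ((1 + E) / 2)) \<le> exp (\<bar>x\<bar> + x\<^sup>2 / 2)"
    by (simp only: exp_le_cancel_iff)
  then have "(1 + E) / 2 \<le> exp (\<bar>x\<bar> + x\<^sup>2 / 2)"
    unfolding exp_ln[OF u(2)] .
  then have "exp (-\<bar>x\<bar>) * ((1 + E) / 2) \<le> exp (-\<bar>x\<bar>) * exp (\<bar>x\<bar> + x\<^sup>2 / 2)"
    by (intro mult_left_mono) auto
  also have "\<dots> = exp (x\<^sup>2 / 2)"
    by (simp flip: exp_add)
  also have "exp (-\<bar>x\<bar>) * ((1 + E) / 2) = (exp (-\<bar>x\<bar>) + exp (-\<bar>x\<bar>) * E) / 2"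
    by (simp add: distrib_left)
  also have "exp (-\<bar>x\<bar>) * E = exp \<bar>x\<bar>"
    unfolding E_def by (simp flip: exp_add)
  also have "(exp (-\<bar>x\<bar>) + exp \<bar>x\<bar>) / 2 = (exp x + exp (-x)) / 2"
    by (cases "x \<ge> 0") auto
  finally show ?thesis .
qed

text \<open>
  Sums of independent random signs are subgaussian: the moment generating function is a product of
  hyperbolic cosines.
\<close>

lemma sign_mean_exp_le:
  assumes "finite J"
  shows "sign_mean J (\<lambda>\<theta>. exp (\<Sum>j\<in>J. \<theta> j * c j)) \<le> exp ((\<Sum>j\<in>J. (c j)\<^sup>2) / 2)"
  using assms
proof (induction J rule: finite_induct)
  case empty
  then show ?case by (simp add: sign_mean_empty)
next
  case (insert j J)
  have upd: "(\<Sum>k\<in>insert j J. (\<theta>(j := s)) k * c k) = s * c j + (\<Sum>k\<in>J. \<theta> k * c k)"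
    for \<theta> :: "'a \<Rightarrow> real" and s
  proof -
    have "(\<Sum>k\<in>J. (\<theta>(j := s)) k * c k) = (\<Sum>k\<in>J. \<theta> k * c k)"
      using insert.hyps by (intro sum.cong) auto
    then show ?thesis using insert.hyps by simp
  qed
  have "sign_mean (insert j J) (\<lambda>\<theta>. exp (\<Sum>k\<in>insert j J. \<theta> k * c k)) =
      (exp (c j) + exp (- c j)) / 2 * sign_mean J (\<lambda>\<theta>. exp (\<Sum>k\<in>J. \<theta> k * c k))"
    unfolding sign_mean_insert[OF insert.hyps] upd exp_add sign_mean_cmult
    by (simp add: algebra_simps add_divide_distrib)
  also have "\<dots> \<le> exp ((c j)\<^sup>2 / 2) * exp ((\<Sum>k\<in>J. (c k)\<^sup>2) / 2)"
    by (intro mult_mono exp_add_exp_uminus_le insert.IH sign_mean_nonneg) auto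
  also have "\<dots> = exp ((\<Sum>k\<in>insert j J. (c k)\<^sup>2) / 2)"
    using insert.hyps by (simp add: add_divide_distrib flip: exp_add)
  finally show ?case .
qed

text \<open>
  The maximum of $|V|$ many subgaussian variables. The majorant \<open>B\<close> stands for the maximum: it
  dominates all the variables at once, and its average can be computed term by term.
\<close>

lemma sign_mean_maximal:
  fixes c :: "'v \<Rightarrow> 'j \<Rightarrow> real"
  assumes "finite J" "finite V" "V \<noteq> {}" "t > 0"
    and q: "\<And>v. v \<in> V \<Longrightarrow> (\<Sum>j\<in>J. (c v j)\<^sup>2) \<le> q"
  shows "\<exists>B. (\<forall>\<theta>. \<forall>v\<in>V. \<bar>\<Sum>j\<in>J. \<theta> j * c v j\<bar> \<le> B \<theta>) \<and>
    sign_mean J B \<le> ln (2 * real (card V)) / t + t * q / 2"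
proof -
  \<comment> \<open>an upper bound for the average of the sum of all the exponentials\<close>
  define W where "W = 2 * real (card V) * exp (t\<^sup>2 * q / 2)"
  have cV: "real (card V) > 0" using assms by (simp add: card_gt_0_iff)
  then have W: "W > 0" by (simp add: W_def)
  let ?X = "\<lambda>\<theta> v. \<Sum>j\<in>J. \<theta> j * c v j"
  let ?e = "\<lambda>\<theta> v. exp (t * ?X \<theta> v) + exp (- (t * ?X \<theta> v))"
  \<comment> \<open>the tangent of the exponential at \<open>ln W\<close> lies below it, so $u \le e^u / W + \ln W - 1$ for $u = t|X|$\<close>
  define B where "B \<theta> = (1 / t) * ((1 / W) * (\<Sum>v\<in>V. ?e \<theta> v) + (ln W - 1))" for \<theta>
  have "\<bar>?X \<theta> v\<bar> \<le> B \<theta>" if v: "v \<in> V" for \<theta> v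
  proof -
    have "t * \<bar>?X \<theta> v\<bar> - ln W + 1 \<le> exp (t * \<bar>?X \<theta> v\<bar> - ln W)"
      using exp_ge_add_one_self[of "t * \<bar>?X \<theta> v\<bar> - ln W"] by linarith
    also have "\<dots> = (1 / W) * exp (t * \<bar>?X \<theta> v\<bar>)"
      using W by (simp add: exp_diff)
    also have "exp (t * \<bar>?X \<theta> v\<bar>) \<le> ?e \<theta> v"
      by (cases "?X \<theta> v \<ge> 0") auto
    also have "?e \<theta> v \<le> (\<Sum>v\<in>V. ?e \<theta> v)"
      using assms v by (intro member_le_sum) (auto intro: add_nonneg_nonneg)
    finally have "t * \<bar>?X \<theta> v\<bar> \<le> (1 / W) * (\<Sum>v\<in>V. ?e \<theta> v) + (ln W - 1)"
      using W by (simp add: divide_right_mono)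
    then show ?thesis
      using assms(4) by (simp add: B_def field_simps)
  qed
  moreover have "sign_mean J B \<le> ln (2 * real (card V)) / t + t * q / 2"
  proof -
    have mgf: "sign_mean J (\<lambda>\<theta>. exp (s * ?X \<theta> v)) \<le> exp (t\<^sup>2 * q / 2)"
      if v: "v \<in> V" and s: "s\<^sup>2 = t\<^sup>2" for v s
    proof -
      have "sign_mean J (\<lambda>\<theta>. exp (s * ?X \<theta> v)) = sign_mean J (\<lambda>\<theta>. exp (\<Sum>j\<in>J. \<theta> j * (s * c v j)))"
        by (simp add: sum_distrib_left mult_ac)
      also have "\<dots> \<le> exp ((\<Sum>j\<in>J. (s * c v j)\<^sup>2) / 2)"
        by (rule sign_mean_exp_le[OF assms(1)])
      also have "(\<Sum>j\<in>J. (s * c v j)\<^sup>2) = t\<^sup>2 * (\<Sum>j\<in>J. (c v j)\<^sup>2)"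
        by (simp add: sum_distrib_left power_mult_distrib s)
      also have "exp (t\<^sup>2 * (\<Sum>j\<in>J. (c v j)\<^sup>2) / 2) \<le> exp (t\<^sup>2 * q / 2)"
        using q[OF v] by (simp add: mult_left_mono)
      finally show ?thesis .
    qed
    have "sign_mean J (\<lambda>\<theta>. \<Sum>v\<in>V. ?e \<theta> v) =
        (\<Sum>v\<in>V. sign_mean J (\<lambda>\<theta>. exp (t * ?X \<theta> v)) + sign_mean J (\<lambda>\<theta>. exp ((-t) * ?X \<theta> v)))"
      by (simp add: sign_mean_sum sign_mean_add)
    also have "\<dots> \<le> (\<Sum>v\<in>V. exp (t\<^sup>2 * q / 2) + exp (t\<^sup>2 * q / 2))"
      by (intro sum_mono add_mono mgf) auto
    also have "\<dots> = W" by (simp add: W_def)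
    finally have "(1 / W) * sign_mean J (\<lambda>\<theta>. \<Sum>v\<in>V. ?e \<theta> v) \<le> 1"
      using W by simp
    then have "(1 / W) * sign_mean J (\<lambda>\<theta>. \<Sum>v\<in>V. ?e \<theta> v) + (ln W - 1) \<le> ln W"
      by simp
    from mult_left_mono[OF this, of "1 / t"] assms(4)
    have "sign_mean J B \<le> (1 / t) * ln W"
      unfolding B_def by (simp only: sign_mean_cmult sign_mean_add sign_mean_const[OF assms(1)]) simp
    also have "ln W = ln (2 * real (card V)) + t\<^sup>2 * q / 2"
      unfolding W_def using cV by (subst ln_mult) auto
    also have "(1 / t) * (ln (2 * real (card V)) + t\<^sup>2 * q / 2) = ln (2 * real (card V)) / t + t * q / 2"
      using assms(4) by (simp add: field_simps power2_eq_square)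
    finally show ?thesis .
  qed
  ultimately show ?thesis by blast
qed

text \<open>
  The maximal inequality for a block of monomials: \<open>T\<close> carries all their variables, which limits the
  number of sign vectors to $4^m$, and each monomial has a variable in \<open>D\<close>, so that the squares of
  the coefficients sum up to at most the sum of the squared influences over \<open>D\<close>.
\<close>

lemma block_maximal:
  fixes s :: "'j \<Rightarrow> 'i set" and a :: "'j \<Rightarrow> real"
  assumes fin: "finite J" "finite T" and m: "m \<ge> 1" "card T \<le> 2 * m" "card D \<le> m" and D: "D \<subseteq> T"
    and K: "K \<subseteq> J" "\<And>j. j \<in> K \<Longrightarrow> s j \<subseteq> T" "\<And>j. j \<in> K \<Longrightarrow> s j \<inter> D \<noteq> {}"
    and \<alpha>: "\<alpha> \<ge> 0" "\<And>i. i \<in> D \<Longrightarrow> (\<Sum>j | j \<in> J \<and> i \<in> s j. (a j)\<^sup>2) \<le> \<alpha>\<^sup>2"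
  shows "\<exists>B. (\<forall>\<theta> x. (\<forall>i\<in>T. x i \<in> {-1, 1}) \<longrightarrow> \<bar>\<Sum>j\<in>K. \<theta> j * a j * (\<Prod>i\<in>s j. x i)\<bar> \<le> B \<theta>) \<and>
    sign_mean J B \<le> 4 * real m * \<alpha>"
proof -
  have finD: "finite D" using D fin finite_subset by auto
  have finK: "finite K" using K(1) fin(1) by (rule finite_subset)
  have "(\<Sum>j\<in>K. (a j)\<^sup>2) \<le> (\<Sum>j\<in>K. \<Sum>i\<in>D. if i \<in> s j then (a j)\<^sup>2 else 0)"
  proof (rule sum_mono)
    fix j assume "j \<in> K"
    then obtain i where "i \<in> s j" "i \<in> D" using K(3) by blast
    then show "(a j)\<^sup>2 \<le> (\<Sum>i\<in>D. if i \<in> s j then (a j)\<^sup>2 else 0)"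
      using member_le_sum[of i D "\<lambda>i. if i \<in> s j then (a j)\<^sup>2 else 0"] finD by auto
  qed
  also have "\<dots> = (\<Sum>i\<in>D. \<Sum>j\<in>K. if i \<in> s j then (a j)\<^sup>2 else 0)"
    by (rule sum.swap)
  also have "\<dots> \<le> (\<Sum>i\<in>D. \<alpha>\<^sup>2)"
  proof (rule sum_mono)
    fix i assume i: "i \<in> D"
    have "(\<Sum>j\<in>K. if i \<in> s j then (a j)\<^sup>2 else 0) \<le> (\<Sum>j\<in>J. if i \<in> s j then (a j)\<^sup>2 else 0)"
      using fin K(1) by (intro sum_mono2) auto
    also have "\<dots> = (\<Sum>j | j \<in> J \<and> i \<in> s j. (a j)\<^sup>2)"
      using fin(1) by (simp add: sum.inter_filter)
    finally show "(\<Sum>j\<in>K. if i \<in> s j then (a j)\<^sup>2 else 0) \<le> \<alpha>\<^sup>2"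
      using \<alpha>(2)[OF i] by linarith
  qed
  also have "\<dots> \<le> m * \<alpha>\<^sup>2"
    using m(3) by (simp add: mult_right_mono)
  finally have energy: "(\<Sum>j\<in>K. (a j)\<^sup>2) \<le> m * \<alpha>\<^sup>2" .
  show ?thesis
  proof (cases "\<alpha> = 0")
    case True
    then have "a j = 0" if "j \<in> K" for j
      using energy that finK sum_nonneg_eq_0_iff[of K "\<lambda>j. (a j)\<^sup>2"] sum_nonneg[of K "\<lambda>j. (a j)\<^sup>2"]
      by auto
    then show ?thesis
      using True by (intro exI[of _ "\<lambda>_. 0"]) (simp add: sign_mean_const fin)
  next
    case False
    with \<alpha>(1) have pos: "\<alpha> > 0" by simp
    let ?V = "sign_arrangements T"
    define c where "c v j = (if j \<in> K then a j * (\<Prod>i\<in>s j. v i) else 0)" for v :: "'i \<Rightarrow> real" and j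
    have c2: "(\<Sum>j\<in>J. (c v j)\<^sup>2) \<le> m * \<alpha>\<^sup>2" if v: "v \<in> ?V" for v
    proof -
      have "(\<Sum>j\<in>J. (c v j)\<^sup>2) = (\<Sum>j\<in>K. (c v j)\<^sup>2)"
        using fin K(1) by (intro sum.mono_neutral_right) (auto simp: c_def)
      also have "\<dots> = (\<Sum>j\<in>K. (a j)\<^sup>2)"
      proof (intro sum.cong refl)
        fix j assume j: "j \<in> K"
        have "(\<Prod>i\<in>s j. v i)\<^sup>2 = (\<Prod>i\<in>s j. (v i)\<^sup>2)"
          by (simp add: prod_power_distrib)
        also have "\<dots> = 1"
        proof (intro prod.neutral ballI)
          fix i assume "i \<in> s j"
          then have "v i \<in> {-1, 1}"
            using v K(2)[OF j] by (auto simp: sign_arrangements_def)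
          then show "(v i)\<^sup>2 = 1" by auto
        qed
        finally show "(c v j)\<^sup>2 = (a j)\<^sup>2"
          using j by (simp add: c_def power_mult_distrib)
      qed
      finally show ?thesis using energy by simp
    qed
    have cV: "real (card ?V) = 2 ^ card T"
      using fin by (simp add: sign_arrangements_def card_PiE)
    have lnV: "ln (2 * real (card ?V)) \<le> 3 * m"
    proof -
      have "2 * real (card ?V) = 2 ^ (1 + card T)"
        by (simp add: cV)
      then have "ln (2 * real (card ?V)) = real (1 + card T) * ln 2"
        by (simp only: ln_realpow)
      also have "\<dots> \<le> real (1 + card T) * 1"
        using ln_2_less_1 by (intro mult_left_mono) auto
      also have "\<dots> \<le> 3 * m" using m by simp
      finally show ?thesis .
    qed
    have "\<exists>B. (\<forall>\<theta>. \<forall>v\<in>?V. \<bar>\<Sum>j\<in>J. \<theta> j * c v j\<bar> \<le> B \<theta>) \<and>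
        sign_mean J B \<le> ln (2 * real (card ?V)) / (1 / \<alpha>) + (1 / \<alpha>) * (m * \<alpha>\<^sup>2) / 2"
    \<comment> \<open>the parameter $1/\alpha$ makes both terms of the maximal inequality of order $m \alpha$\<close>
    proof (rule sign_mean_maximal)
      show "0 < 1 / \<alpha>" using pos by simp
    qed (use fin c2 in \<open>auto simp: finite_sign_arrangements sign_arrangements_nonempty\<close>)
    then obtain B where B: "(\<forall>\<theta>. \<forall>v\<in>?V. \<bar>\<Sum>j\<in>J. \<theta> j * c v j\<bar> \<le> B \<theta>) \<and>
        sign_mean J B \<le> ln (2 * real (card ?V)) / (1 / \<alpha>) + (1 / \<alpha>) * (m * \<alpha>\<^sup>2) / 2" ..
    have "\<bar>\<Sum>j\<in>K. \<theta> j * a j * (\<Prod>i\<in>s j. x i)\<bar> \<le> B \<theta>" if x: "\<forall>i\<in>T. x i \<in> {-1, 1}" for \<theta> x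
    proof -
      have "restrict x T \<in> ?V"
        using x unfolding sign_arrangements_def by (subst restrict_PiE_iff)
      moreover have "(\<Sum>j\<in>J. \<theta> j * c (restrict x T) j) = (\<Sum>j\<in>K. \<theta> j * a j * (\<Prod>i\<in>s j. x i))"
      proof (rule sum.mono_neutral_cong_right)
        fix j assume j: "j \<in> K"
        have "(\<Prod>i\<in>s j. restrict x T i) = (\<Prod>i\<in>s j. x i)"
          using K(2)[OF j] by (intro prod.cong) auto
        then show "\<theta> j * c (restrict x T) j = \<theta> j * a j * (\<Prod>i\<in>s j. x i)"
          using j by (simp add: c_def)
      qed (use fin K(1) in \<open>auto simp: c_def\<close>)
      moreover note conjunct1[OF B, rule_format, of "restrict x T" \<theta>]
      ultimately show ?thesis by simp
    qed
    moreover have "sign_mean J B \<le> 4 * real m * \<alpha>"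
    proof -
      have "ln (2 * real (card ?V)) / (1 / \<alpha>) + (1 / \<alpha>) * (m * \<alpha>\<^sup>2) / 2 = ln (2 * real (card ?V)) * \<alpha> + m * \<alpha> / 2"
        using pos by (simp add: power2_eq_square)
      also have "\<dots> \<le> (3 * m) * \<alpha> + m * \<alpha>"
        using pos lnV by (intro add_mono mult_right_mono) auto
      finally show ?thesis using conjunct2[OF B] by (simp add: algebra_simps)
    qed
    ultimately show ?thesis by blast
  qed
qed

text \<open>
  Cauchy condensation: the value at $2^{k+1} - 1$ is at most every value with an index in
  $[2^k, 2^{k+1})$, and there are $2^k$ of these.
\<close>

lemma dyadic_condensation:
  fixes \<alpha> :: "nat \<Rightarrow> real"
  assumes "antimono \<alpha>" "\<And>n. \<alpha> n \<ge> 0"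
  shows "(\<Sum>k<Suc L. 2 ^ k * \<alpha> (2 ^ k - 1)) \<le> 2 * (\<Sum>n<2 ^ L. \<alpha> n)"
proof (induction L)
  case 0
  then show ?case using assms(2)[of 0] by simp
next
  case (Suc L)
  have "2 ^ L * \<alpha> (2 ^ Suc L - 1) = (\<Sum>n = 2 ^ L..<(2::nat) ^ Suc L. \<alpha> (2 ^ Suc L - 1))"
    by simp
  also have "\<dots> \<le> (\<Sum>n = 2 ^ L..<2 ^ Suc L. \<alpha> n)"
    by (intro sum_mono antimonoD[OF assms(1)]) auto
  also have "\<dots> = (\<Sum>n<2 ^ Suc L. \<alpha> n) - (\<Sum>n<2 ^ L. \<alpha> n)"
    using sum.atLeastLessThan_concat[of 0 "2 ^ L" "2 ^ Suc L" \<alpha>] by (simp add: atLeast0LessThan)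
  finally show ?case using Suc.IH by simp
qed

lemma ex_decreasing_enumeration:
  fixes f :: "'i \<Rightarrow> real"
  assumes "finite I"
  shows "\<exists>e. bij_betw e {..<card I} I \<and> (\<forall>k l. k \<le> l \<longrightarrow> l < card I \<longrightarrow> f (e l) \<le> f (e k))"
proof -
  obtain ys where ys: "set ys = I" "distinct ys"
    using finite_distinct_list[OF assms] by blast
  define xs where "xs = sort_key (\<lambda>i. - f i) ys"
  have xs: "set xs = I" "distinct xs" "sorted (map (\<lambda>i. - f i) xs)"
    using ys by (simp_all add: xs_def)
  then have len: "length xs = card I" using distinct_card by force
  have "f (xs ! l) \<le> f (xs ! k)" if "k \<le> l" "l < card I" for k l
    using sorted_nth_mono[OF xs(3), of k l] that len by simp
  moreover have "bij_betw ((!) xs) {..<card I} I"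
    using bij_betw_nth[OF xs(2)] xs(1) len by simp
  ultimately show ?thesis by blast
qed

text \<open>
  A monomial enters block $k$ when its variables lie among the first $2^{k+1} - 1$ coordinates, but
  not among the first $2^k - 1$. Then it contains one of the at most $2^k$ new coordinates, and all of
  these have an influence at most that of the first of them, since the coordinates are sorted.
\<close>

lemma random_sup_le_sum_influences:
  fixes s :: "'j \<Rightarrow> 'i set" and a :: "'j \<Rightarrow> real"
  assumes fin: "finite J" "finite I" and s: "\<And>j. j \<in> J \<Longrightarrow> s j \<subseteq> I" "\<And>j. j \<in> J \<Longrightarrow> s j \<noteq> {}"
  shows "\<exists>B. (\<forall>\<theta> x. (\<forall>i\<in>I. x i \<in> {-1, 1}) \<longrightarrow> \<bar>\<Sum>j\<in>J. \<theta> j * a j * (\<Prod>i\<in>s j. x i)\<bar> \<le> B \<theta>) \<and>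
    sign_mean J B \<le> 8 * (\<Sum>i\<in>I. sqrt (\<Sum>j | j \<in> J \<and> i \<in> s j. (a j)\<^sup>2))"
proof -
  define A where "A i = sqrt (\<Sum>j | j \<in> J \<and> i \<in> s j. (a j)\<^sup>2)" for i
  have A: "A i \<ge> 0" "(A i)\<^sup>2 = (\<Sum>j | j \<in> J \<and> i \<in> s j. (a j)\<^sup>2)" for i
    by (simp_all add: A_def sum_nonneg)
  define N where "N = card I"
  obtain e where e: "bij_betw e {..<N} I"
    and mono: "\<And>k l. k \<le> l \<Longrightarrow> l < N \<Longrightarrow> A (e l) \<le> A (e k)"
    using ex_decreasing_enumeration[OF fin(2), of A] unfolding N_def by blast
  define \<alpha> where "\<alpha> n = (if n < N then A (e n) else 0)" for n
  have \<alpha>: "antimono \<alpha>" "\<And>n. \<alpha> n \<ge> 0"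
    using mono A(1) by (auto simp: \<alpha>_def intro!: antimonoI)
  \<comment> \<open>starting with no coordinates, so that every monomial with a variable lies in some block\<close>
  define T where "T k = e ` ({..<2 ^ k - 1} \<inter> {..<N})" for k :: nat
  have T0: "T 0 = {}" by (simp add: T_def)
  have finT: "finite (T k)" for k by (simp add: T_def)
  have TSuc: "T k \<subseteq> T (Suc k)" for k
  proof -
    have "(2::nat) ^ k - 1 \<le> 2 ^ Suc k - 1" by simp
    then show ?thesis unfolding T_def by (intro image_mono) auto
  qed
  have TN: "T N = I"
  proof -
    have "N \<le> 2 ^ N - 1"
      using less_exp[of N] by linarith
    then have "{..<2 ^ N - 1} \<inter> {..<N} = {..<N}" by auto
    then show ?thesis using e by (simp add: T_def bij_betw_def)
  qed
  define K where "K k = {j \<in> J. s j \<subseteq> T (Suc k) \<and> \<not> s j \<subseteq> T k}" for k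
  have split: "(\<Sum>j\<in>J. f j) = (\<Sum>k<N. \<Sum>j\<in>K k. f j)" for f :: "'j \<Rightarrow> real"
  proof -
    have "(\<Sum>j | j \<in> J \<and> s j \<subseteq> T n. f j) = (\<Sum>k<n. \<Sum>j\<in>K k. f j)" for n
    proof (induction n)
      case 0
      have "{j. j \<in> J \<and> s j \<subseteq> T 0} = {}" using s(2) T0 by auto
      then show ?case by (simp only: sum.empty) simp
    next
      case (Suc n)
      have "{j. j \<in> J \<and> s j \<subseteq> T (Suc n)} = {j. j \<in> J \<and> s j \<subseteq> T n} \<union> K n"
        using TSuc[of n] by (auto simp: K_def)
      then have "(\<Sum>j | j \<in> J \<and> s j \<subseteq> T (Suc n). f j) =
          (\<Sum>j | j \<in> J \<and> s j \<subseteq> T n. f j) + (\<Sum>j\<in>K n. f j)"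
        using fin(1) by (simp only:) (rule sum.union_disjoint, auto simp: K_def)
      then show ?case using Suc.IH by simp
    qed
    from this[of N] have "(\<Sum>j | j \<in> J \<and> s j \<subseteq> I. f j) = (\<Sum>k<N. \<Sum>j\<in>K k. f j)"
      by (simp add: TN)
    also have "{j. j \<in> J \<and> s j \<subseteq> I} = J" using s(1) by auto
    finally show ?thesis .
  qed
  define P where "P k B \<longleftrightarrow> (\<forall>\<theta> x. (\<forall>i\<in>T (Suc k). x i \<in> {-1, 1}) \<longrightarrow>
        \<bar>\<Sum>j\<in>K k. \<theta> j * a j * (\<Prod>i\<in>s j. x i)\<bar> \<le> B \<theta>) \<and>
      sign_mean J B \<le> 4 * real (2 ^ k) * \<alpha> (2 ^ k - 1)" for k B
  have "\<exists>B. P k B" for k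
    unfolding P_def
  proof (rule block_maximal)
    have diff: "T (Suc k) - T k \<subseteq> e ` ({2 ^ k - 1..<2 ^ Suc k - 1} \<inter> {..<N})"
    proof
      fix i assume i: "i \<in> T (Suc k) - T k"
      then obtain n where n: "i = e n" "n < 2 ^ Suc k - 1" "n < N" by (auto simp: T_def)
      moreover have "\<not> n < 2 ^ k - 1" using i n(1,3) by (auto simp: T_def)
      ultimately show "i \<in> e ` ({2 ^ k - 1..<2 ^ Suc k - 1} \<inter> {..<N})" by auto
    qed
    have "card (T (Suc k)) \<le> card ({..<2 ^ Suc k - 1} \<inter> {..<N})"
      unfolding T_def by (intro card_image_le) auto
    also have "\<dots> \<le> card {..<(2::nat) ^ Suc k - 1}"
      by (intro card_mono) auto
    finally show "card (T (Suc k)) \<le> 2 * 2 ^ k" by simp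
    have "card (T (Suc k) - T k) \<le> card ({2 ^ k - 1..<2 ^ Suc k - 1} \<inter> {..<N})"
      by (rule surj_card_le[OF _ diff]) auto
    also have "\<dots> \<le> card {(2::nat) ^ k - 1..<2 ^ Suc k - 1}"
      by (intro card_mono) auto
    finally show "card (T (Suc k) - T k) \<le> 2 ^ k" by simp
    show "(\<Sum>j | j \<in> J \<and> i \<in> s j. (a j)\<^sup>2) \<le> (\<alpha> (2 ^ k - 1))\<^sup>2" if i: "i \<in> T (Suc k) - T k" for i
    proof -
      obtain n where n: "i = e n" "2 ^ k - 1 \<le> n" "n < N" using subsetD[OF diff i] by auto
      then have "A i \<le> \<alpha> (2 ^ k - 1)" using mono by (simp add: \<alpha>_def)
      then show ?thesis unfolding A(2)[symmetric] using A(1) by (intro power_mono) auto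
    qed
  qed (use fin finT \<alpha> in \<open>auto simp: K_def\<close>)
  then obtain B where "P k (B k)" for k
    by metis
  then have B: "\<forall>i\<in>T (Suc k). x i \<in> {-1, 1} \<Longrightarrow>
        \<bar>\<Sum>j\<in>K k. \<theta> j * a j * (\<Prod>i\<in>s j. x i)\<bar> \<le> B k \<theta>"
    and sign_mean_B: "sign_mean J (B k) \<le> 4 * real (2 ^ k) * \<alpha> (2 ^ k - 1)" for k \<theta> x
    unfolding P_def by blast+
  have bound: "\<bar>\<Sum>j\<in>J. \<theta> j * a j * (\<Prod>i\<in>s j. x i)\<bar> \<le> (\<Sum>k<N. B k \<theta>)" if x: "\<forall>i\<in>I. x i \<in> {-1, 1}" for \<theta> x
  proof -
    have TI: "T k \<subseteq> I" for k using e by (auto simp: T_def bij_betw_def)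
    have "\<bar>\<Sum>j\<in>J. \<theta> j * a j * (\<Prod>i\<in>s j. x i)\<bar> \<le>
        (\<Sum>k<N. \<bar>\<Sum>j\<in>K k. \<theta> j * a j * (\<Prod>i\<in>s j. x i)\<bar>)"
      unfolding split by (rule sum_abs)
    also have "\<dots> \<le> (\<Sum>k<N. B k \<theta>)"
      using x TI by (intro sum_mono B) blast
    finally show ?thesis .
  qed
  have mean: "sign_mean J (\<lambda>\<theta>. \<Sum>k<N. B k \<theta>) \<le> 8 * (\<Sum>i\<in>I. A i)"
  proof -
    have "sign_mean J (\<lambda>\<theta>. \<Sum>k<N. B k \<theta>) \<le> (\<Sum>k<N. 4 * (2 ^ k * \<alpha> (2 ^ k - 1)))"
      unfolding sign_mean_sum using sign_mean_B by (intro sum_mono) (simp add: mult.assoc)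
    also have "\<dots> \<le> (\<Sum>k<Suc N. 4 * (2 ^ k * \<alpha> (2 ^ k - 1)))"
      using \<alpha>(2) by simp
    also have "\<dots> = 4 * (\<Sum>k<Suc N. 2 ^ k * \<alpha> (2 ^ k - 1))"
      by (simp only: sum_distrib_left)
    also have "\<dots> \<le> 4 * (2 * (\<Sum>n<2 ^ N. \<alpha> n))"
      by (intro mult_left_mono dyadic_condensation \<alpha>) simp
    also have "(\<Sum>n<2 ^ N. \<alpha> n) = (\<Sum>n<N. A (e n))"
      using less_exp[of N] by (intro sum.mono_neutral_cong_right) (auto simp: \<alpha>_def)
    also have "\<dots> = (\<Sum>i\<in>I. A i)"
      by (rule sum.reindex_bij_betw[OF e])
    finally show ?thesis by simp
  qed
  show ?thesis
    unfolding A_def[symmetric]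
  proof (intro exI conjI allI impI)
    show "sign_mean J (\<lambda>\<theta>. \<Sum>k<N. B k \<theta>) \<le> 8 * (\<Sum>i\<in>I. A i)" by (rule mean)
  qed (rule bound)
qed

section \<open>The uniform norm as a maximum over the sign cube\<close>

text \<open>
  The signs of $r_1, \dots, r_n$ on a dyadic interval of length $2^{-n}$ are given by the binary
  digits of its index, so every pattern of signs occurs.
\<close>

lemma ex_dyadic_with_signs:
  assumes "\<And>i. i \<in> {1..n} \<Longrightarrow> x i \<in> {-1, 1}"
  shows "\<exists>k<2 ^ n. \<forall>i\<in>{1..n}. (-1) ^ (k div 2 ^ (n - i)) = (x i :: real)"
  using assms
proof (induction n)
  case 0
  then show ?case by auto
next
  case (Suc n)
  from Suc.IH Suc.prems obtain k where
    k: "k < 2 ^ n" "\<And>i. i \<in> {1..n} \<Longrightarrow> (-1) ^ (k div 2 ^ (n - i)) = x i" by force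
  define b :: nat where "b = (if x (Suc n) = 1 then 0 else 1)"
  have b: "b < 2" "(-1) ^ (2 * k + b) = x (Suc n)"
    using Suc.prems[of "Suc n"] by (auto simp: b_def power_add)
  show ?case
  proof (intro exI[of _ "2 * k + b"] conjI ballI)
    show "2 * k + b < 2 ^ Suc n" using k(1) b(1) by simp
    fix i assume i: "i \<in> {1..Suc n}"
    show "(-1) ^ ((2 * k + b) div 2 ^ (Suc n - i)) = x i"
    proof (cases "i = Suc n")
      case False
      with i have i': "i \<in> {1..n}" "Suc n - i = Suc (n - i)" by auto
      have "(2 * k + b) div 2 ^ (Suc n - i) = (2 * k + b) div 2 div 2 ^ (n - i)"
        by (simp add: i'(2) div_mult2_eq)
      also have "(2 * k + b) div 2 = k" using b(1) by simp
      finally show ?thesis using k(2)[OF i'(1)] by simp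
    qed (use b(2) in simp)
  qed
qed

text \<open>
  On this interval, $\lfloor 2^i t \rfloor$ consists of the leading $i$ of the $n$ binary digits
  of \<open>k\<close>.
\<close>

lemma rademacher_on_dyadic_interval:
  assumes "i \<le> n" and t: "real k / 2 ^ n \<le> t" "t < real (k + 1) / 2 ^ n"
  shows "rademacher i t = (-1) ^ (k div 2 ^ (n - i))"
proof -
  define D :: nat where "D = 2 ^ (n - i)"
  define q where "q = k div D"
  have D: "D > 0" "(2::real) ^ n = 2 ^ i * real D"
    using assms(1) by (simp_all add: D_def flip: power_add)
  have "q * D \<le> k" "k < (q + 1) * D"
    using D(1) div_times_less_eq_dividend dividend_less_div_times[of D k] by (auto simp: q_def algebra_simps)
  then have kq: "q * D \<le> k" "k + 1 \<le> (q + 1) * D" by simp_all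
  from of_nat_mono[OF kq(1), where 'a = real] of_nat_mono[OF kq(2), where 'a = real]
  have kq': "real q * real D \<le> real k" "real (k + 1) \<le> (real q + 1) * real D"
    by (simp_all only: of_nat_mult of_nat_add of_nat_1)
  have "real k \<le> (2 ^ i * t) * real D" "(2 ^ i * t) * real D < real (k + 1)"
    using t D by (simp_all add: field_simps)
  with kq' have "real q * real D \<le> (2 ^ i * t) * real D" "(2 ^ i * t) * real D < (real q + 1) * real D"
    by linarith+
  then have "real q \<le> 2 ^ i * t" "2 ^ i * t < real q + 1"
    using D(1) by simp_all
  then have "\<lfloor>2 ^ i * t\<rfloor> = int q"
    by (intro floor_unique) auto
  then show ?thesis by (simp add: rademacher_def q_def D_def)
qed

lemma rademacher_chaos_eq_prod:
  assumes "j \<in> chaos_indices d n"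
  shows "rademacher_chaos j t = (\<Prod>i\<in>set j. rademacher i t)"
proof -
  have "distinct j" using assms by (simp add: chaos_indices_def strict_sorted_iff)
  then show ?thesis by (simp add: rademacher_chaos_def prod.distinct_set_conv_list)
qed

lemma Linf_norm_chaos_le:
  assumes "\<And>x. \<forall>i\<in>{1..n}. x i \<in> {-1, 1} \<Longrightarrow>
      \<bar>\<Sum>j\<in>chaos_indices d n. c j * (\<Prod>i\<in>set j. x i)\<bar> \<le> B"
  shows "Linf_norm (\<lambda>t. \<Sum>j\<in>chaos_indices d n. c j * rademacher_chaos j t) \<le> B"
proof -
  let ?f = "\<lambda>t. \<Sum>j\<in>chaos_indices d n. c j * rademacher_chaos j t"
  have bound: "\<bar>?f t\<bar> \<le> B" for t
  proof -
    have "rademacher i t \<in> {-1, 1}" for i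
      unfolding rademacher_def by (cases "even (nat \<lfloor>2 ^ i * t\<rfloor>)") auto
    then have "\<bar>\<Sum>j\<in>chaos_indices d n. c j * (\<Prod>i\<in>set j. rademacher i t)\<bar> \<le> B"
      by (intro assms) blast
    then show ?thesis
      by (simp add: rademacher_chaos_eq_prod cong: sum.cong)
  qed
  have "?f \<in> borel_measurable borel"
    by (intro borel_measurable_sum borel_measurable_times rademacher_chaos_measurable
        borel_measurable_const)
  then have "?f \<in> borel_measurable lebesgue"
    by (simp add: measurable_completion)
  then have "(\<lambda>t. ereal \<bar>?f t\<bar>) \<in> borel_measurable (lebesgue_on {0..1})"
    by (intro borel_measurable_ereal borel_measurable_abs measurable_restrict_space1)
  then have "ereal (Linf_norm ?f) \<le> ereal B"
    unfolding Linf_norm_chaos using bound by (intro esssup_I) auto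
  then show ?thesis by simp
qed

text \<open>
  A sign vector is attained by the Rademacher functions on a whole dyadic interval. This has positive
  measure, so the essential supremum cannot ignore the value there.
\<close>

lemma abs_le_Linf_norm_chaos:
  assumes "\<forall>i\<in>{1..n}. x i \<in> {-1, 1}"
  shows "\<bar>\<Sum>j\<in>chaos_indices d n. c j * (\<Prod>i\<in>set j. x i)\<bar> \<le>
    Linf_norm (\<lambda>t. \<Sum>j\<in>chaos_indices d n. c j * rademacher_chaos j t)"
proof (rule ccontr)
  let ?f = "\<lambda>t. \<Sum>j\<in>chaos_indices d n. c j * rademacher_chaos j t"
  assume "\<not> ?thesis"
  then have less: "Linf_norm ?f < \<bar>\<Sum>j\<in>chaos_indices d n. c j * (\<Prod>i\<in>set j. x i)\<bar>" by simp
  obtain k where k: "k < 2 ^ n" "\<And>i. i \<in> {1..n} \<Longrightarrow> (-1) ^ (k div 2 ^ (n - i)) = x i"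
    using ex_dyadic_with_signs[of n x] assms by blast
  let ?S = "{real k / 2 ^ n..<real (k + 1) / 2 ^ n}"
  have f_eq: "?f t = (\<Sum>j\<in>chaos_indices d n. c j * (\<Prod>i\<in>set j. x i))" if "t \<in> ?S" for t
  proof (intro sum.cong refl)
    fix j assume j: "j \<in> chaos_indices d n"
    have "(\<Prod>i\<in>set j. rademacher i t) = (\<Prod>i\<in>set j. x i)"
    proof (intro prod.cong refl)
      fix i assume "i \<in> set j"
      then have "i \<in> {1..n}" using j by (auto simp: chaos_indices_def)
      then show "rademacher i t = x i"
        using rademacher_on_dyadic_interval[of i n k t] that k(2) by auto
    qed
    then show "c j * rademacher_chaos j t = c j * (\<Prod>i\<in>set j. x i)"
      by (simp add: rademacher_chaos_eq_prod[OF j])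
  qed
  have "AE t in lebesgue_on {0..1}. ereal \<bar>?f t\<bar> \<le> ereal (Linf_norm ?f)"
    unfolding Linf_norm_chaos by (rule esssup_AE)
  then have "AE t in lebesgue. t \<in> {0..1} \<longrightarrow> \<bar>?f t\<bar> \<le> Linf_norm ?f"
    by (subst (asm) AE_restrict_space_iff) auto
  then have "AE t in lebesgue. t \<notin> ?S"
  proof (rule AE_mp, intro AE_I2 impI notI)
    fix t assume t: "t \<in> ?S" and *: "t \<in> {0..1} \<longrightarrow> \<bar>?f t\<bar> \<le> Linf_norm ?f"
    have "real k + 1 \<le> 2 ^ n"
      using k(1) by (metis Suc_leI of_nat_Suc of_nat_le_iff of_nat_numeral of_nat_power add.commute)
    then have "real (k + 1) / 2 ^ n \<le> 1" by simp
    moreover have "0 \<le> real k / 2 ^ n" by simp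
    ultimately have "t \<in> {0..1}" using t by (meson atLeastAtMost_iff atLeastLessThan_iff less_imp_le order_trans)
    then show False using * less f_eq[OF t] by simp
  qed
  then have "emeasure lebesgue ?S = 0"
    by (subst (asm) AE_iff_measurable[where N = ?S]) auto
  then show False
    by (simp add: divide_right_mono emeasure_lborel_Ico flip: diff_divide_distrib)
qed

section \<open>Random unconditional convergence\<close>

text \<open>
  Increasing tuples correspond to their sets of entries; this turns coefficients indexed by tuples
  into coefficients indexed by sets. The hypothesis on \<open>h\<close> lets the subsets that are not supports of
  a tuple drop out of the sum.
\<close>

lemma sum_over_chaos_supports:
  fixes a :: "nat list \<Rightarrow> real" and d n :: nat
  defines "b \<equiv> \<lambda>S. if S \<in> set ` chaos_indices d n then a (sorted_list_of_set S) else 0"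
  assumes "\<And>S. h S 0 = (0::real)"
  shows "(\<Sum>S\<in>Pow {1..n}. h S (b S)) = (\<Sum>j\<in>chaos_indices d n. h (set j) (a j))"
proof -
  let ?J = "chaos_indices d n"
  have sorted: "sorted_list_of_set (set j) = j" if "j \<in> ?J" for j
    using that by (auto simp: chaos_indices_def strict_sorted_iff sorted_list_of_set.idem_if_sorted_distinct)
  have "(\<Sum>S\<in>Pow {1..n}. h S (b S)) = (\<Sum>S\<in>set ` ?J. h S (b S))"
    using assms(2) by (intro sum.mono_neutral_right) (auto simp: b_def chaos_indices_def)
  also have "\<dots> = (\<Sum>j\<in>?J. h (set j) (b (set j)))"
    by (rule sum.reindex_cong[OF inj_on_inverseI[of _ sorted_list_of_set]]) (auto simp: sorted)
  also have "\<dots> = (\<Sum>j\<in>?J. h (set j) (a j))"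
    by (intro sum.cong refl) (auto simp: b_def sorted)
  finally show ?thesis .
qed

theorem corollary7:
  fixes d :: nat
  assumes "d \<ge> 1"
  shows "\<exists>C::real. C > 0 \<and> (\<forall>(n::nat) (a :: nat list \<Rightarrow> real).
    measure_pmf.expectation (pmf_of_set (sign_arrangements (chaos_indices d n)))
      (\<lambda>\<theta>. Linf_norm (\<lambda>t. \<Sum>j\<in>chaos_indices d n. \<theta> j * a j * rademacher_chaos j t))
    \<le> C * Linf_norm (\<lambda>t. \<Sum>j\<in>chaos_indices d n. a j * rademacher_chaos j t))"
proof (rule sum_influences_le[OF assms])
  fix C
  assume C: "C > 0"
    "\<And>I (b :: nat set \<Rightarrow> real) M. finite I \<Longrightarrow> (\<And>S. S \<subseteq> I \<Longrightarrow> d < card S \<Longrightarrow> b S = 0) \<Longrightarrow>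
      (\<And>x. x \<in> sign_arrangements I \<Longrightarrow> \<bar>walsh_poly I b x\<bar> \<le> M) \<Longrightarrow>
      (\<Sum>i\<in>I. sqrt (\<Sum>S | S \<subseteq> I \<and> i \<in> S. (b S)\<^sup>2)) \<le> C * M"
  show ?thesis
  proof (intro exI[of _ "8 * C"] conjI allI)
    fix n :: nat and a :: "nat list \<Rightarrow> real"
    let ?J = "chaos_indices d n" and ?I = "{1..n}"
    let ?M = "Linf_norm (\<lambda>t. \<Sum>j\<in>?J. a j * rademacher_chaos j t)"
    let ?A = "\<lambda>i. sqrt (\<Sum>j | j \<in> ?J \<and> i \<in> set j. (a j)\<^sup>2)"
    define b where "b S = (if S \<in> set ` ?J then a (sorted_list_of_set S) else 0)" for S
    have lower: "(\<Sum>i\<in>?I. ?A i) \<le> C * ?M"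
    proof -
      have influence: "(\<Sum>S | S \<subseteq> ?I \<and> i \<in> S. (b S)\<^sup>2) = (\<Sum>j | j \<in> ?J \<and> i \<in> set j. (a j)\<^sup>2)" for i
      proof -
        have "(\<Sum>S | S \<subseteq> ?I \<and> i \<in> S. (b S)\<^sup>2) = (\<Sum>S\<in>Pow ?I. if i \<in> S then (b S)\<^sup>2 else 0)"
          by (intro sum.mono_neutral_cong_left) auto
        also have "\<dots> = (\<Sum>j\<in>?J. if i \<in> set j then (a j)\<^sup>2 else 0)"
          unfolding b_def by (rule sum_over_chaos_supports) simp
        also have "\<dots> = (\<Sum>j | j \<in> ?J \<and> i \<in> set j. (a j)\<^sup>2)"
          by (simp add: sum.inter_filter finite_chaos_indices)
        finally show ?thesis .
      qed
      have "(\<Sum>i\<in>?I. sqrt (\<Sum>S | S \<subseteq> ?I \<and> i \<in> S. (b S)\<^sup>2)) \<le> C * ?M"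
      proof (rule C(2))
        show "b S = 0" if "S \<subseteq> ?I" "d < card S" for S
          using that by (auto simp: b_def chaos_indices_def distinct_card strict_sorted_iff)
        show "\<bar>walsh_poly ?I b x\<bar> \<le> ?M" if "x \<in> sign_arrangements ?I" for x
        proof -
          have "walsh_poly ?I b x = (\<Sum>j\<in>?J. a j * (\<Prod>i\<in>set j. x i))"
            unfolding walsh_poly_def b_def by (rule sum_over_chaos_supports) simp
          moreover have "\<forall>i\<in>?I. x i \<in> {-1, 1}"
            using that by (auto simp: sign_arrangements_def)
          ultimately show ?thesis
            using abs_le_Linf_norm_chaos[of n x a d] by simp
        qed
      qed simp
      then show ?thesis by (simp only: influence)
    qed
    have "\<exists>B. (\<forall>\<theta> x. (\<forall>i\<in>?I. x i \<in> {-1, 1}) \<longrightarrow>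
          \<bar>\<Sum>j\<in>?J. \<theta> j * a j * (\<Prod>i\<in>set j. x i)\<bar> \<le> B \<theta>) \<and>
        sign_mean ?J B \<le> 8 * (\<Sum>i\<in>?I. ?A i)"
    proof (rule random_sup_le_sum_influences)
      show "set j \<noteq> {}" if "j \<in> ?J" for j
        using that assms by (auto simp: chaos_indices_def)
    qed (auto simp: finite_chaos_indices, auto simp: chaos_indices_def)
    then obtain B where B: "(\<forall>\<theta> x. (\<forall>i\<in>?I. x i \<in> {-1, 1}) \<longrightarrow>
          \<bar>\<Sum>j\<in>?J. \<theta> j * a j * (\<Prod>i\<in>set j. x i)\<bar> \<le> B \<theta>) \<and>
        sign_mean ?J B \<le> 8 * (\<Sum>i\<in>?I. ?A i)" ..
    have "measure_pmf.expectation (pmf_of_set (sign_arrangements ?J))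
          (\<lambda>\<theta>. Linf_norm (\<lambda>t. \<Sum>j\<in>?J. \<theta> j * a j * rademacher_chaos j t)) =
        sign_mean ?J (\<lambda>\<theta>. Linf_norm (\<lambda>t. \<Sum>j\<in>?J. \<theta> j * a j * rademacher_chaos j t))"
      by (rule sign_mean_eq_expectation[OF finite_chaos_indices])
    also have "\<dots> \<le> sign_mean ?J B"
      by (intro sign_mean_mono Linf_norm_chaos_le conjunct1[OF B, THEN spec, THEN spec, THEN mp])
    also have "\<dots> \<le> 8 * (\<Sum>i\<in>?I. ?A i)"
      using B by (rule conjunct2)
    also have "\<dots> \<le> 8 * C * ?M"
      using lower by simp
    finally show "measure_pmf.expectation (pmf_of_set (sign_arrangements ?J))
        (\<lambda>\<theta>. Linf_norm (\<lambda>t. \<Sum>j\<in>?J. \<theta> j * a j * rademacher_chaos j t)) \<le> 8 * C * ?M" .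
  next
    show "0 < 8 * C" using C(1) by simp
  qed
qed

end
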